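(* Let $y \in \mathbb{R}$. Then $$\int_0^\infty\left(\frac{x}{x^2 + y^2} - \frac{x}{x^2 + y^2}\tanh\left(\frac{\pi x}{2}\right)\right) dx = \psi\left(\frac{1 + |y| }{2}\right) + \ln\frac{2}{|y|}\qquad (y \neq 0),$$ $$\int_0^\infty\left(\frac{\tanh\left(\frac{\pi x}{2}\right)}{x} - \frac{x}{x^2 + y^2}\right)dx = \gamma + \ln\left(2|y| \right)\qquad (y\neq 0),$$ and, for every $y\in\mathbb{R}$, $$\int_0^\infty \tanh\left( \frac{\pi x}{2}\right)\left(\frac{1}{x} - \frac{x}{x^2 + y^2}\right) dx = -\psi\left(\frac{1}{2}\right) + \psi\left(\frac{1 + |y| }{2}\right).$$
   Context: $\psi=\Gamma'/\Gamma$ is the digamma function and $\gamma$ is Euler's constant. *)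

theory Defs
  imports "HOL-Analysis.Analysis"
begin

end

theory Submission
  imports Defs "HOL-Real_Asymp.Real_Asymp"
begin

text \<open>
  Everything rests on the partial fraction expansion
  \<open>tanh (\<pi>x/2) = \<Sum>k. 4x / (\<pi> (x\<^sup>2 + (2k+1)\<^sup>2))\<close>, which is Euler's reflection formula for the digamma
  function on the line \<open>Re z = 1/2\<close>. Multiplied by \<open>1/x - x/(x\<^sup>2 + y\<^sup>2) = y\<^sup>2 / (x (x\<^sup>2 + y\<^sup>2))\<close> it turns
  the third integrand into a series of positive rational functions, each with an elementary integral.
  By monotone convergence the third integral is the sum of
  \<open>1/(k + 1/2) - 1/(k + (1+y)/2)\<close>, which is \<open>\<psi>((1+y)/2) - \<psi>(1/2)\<close>
  (lemma \<open>has_integral_tanh_kernel\<close>).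

  Write \<open>I(y)\<close> for the first integral with \<open>y > 0\<close>. Subtracting the difference of two third integrals from
  \<open>\<integral> (x/(x\<^sup>2+a\<^sup>2) - x/(x\<^sup>2+b\<^sup>2)) dx = ln (b/a)\<close> cancels the terms \<open>tanh (\<pi>x/2) / x\<close> and shows that
  \<open>I(y) - \<psi>((1+y)/2) - ln (2/y)\<close> does not depend on \<open>y\<close>. The constant is \<open>0\<close>:
  \<open>1 - tanh (\<pi>x/2)\<close> decays exponentially, so \<open>I(y) = O(1/y)\<close>, and along the odd integers \<open>y = 2n + 1\<close>
  the digamma value is \<open>H\<^sub>n - \<gamma>\<close>, where \<open>H\<^sub>n\<close> is a harmonic number, so that the logarithmic
  term cancels it in the limit by the definition of \<open>\<gamma>\<close>
  (lemma \<open>has_integral_one_minus_tanh_kernel\<close>).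

  The second integral is the third minus the first, and \<open>\<psi>(1/2) = -\<gamma> - 2 ln 2\<close>.
\<close>

section \<open>Elementary integrals over the half-line\<close>

lemma has_integral_FTC_greaterThan:
  fixes f F :: "real \<Rightarrow> real"
  assumes deriv: "\<And>x. x \<ge> a \<Longrightarrow> (F has_real_derivative f x) (at x)"
    and nonneg: "\<And>x. x \<ge> a \<Longrightarrow> f x \<ge> 0"
    and lim: "(F \<longlongrightarrow> L) at_top"
  shows "(f has_integral (L - F a)) {a<..}"
proof -
  define g where "g = (\<lambda>(n::nat) x. if x \<in> {a..a + real n} then f x else 0)"
  have "(f has_integral (L - F a)) {a..}"
  proof (rule has_integral_monotone_convergence_increasing)
    fix n :: nat
    have "(f has_integral (F (a + real n) - F a)) {a..a + real n}"
      by (rule fundamental_theorem_of_calculus)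
        (auto intro!: has_field_derivative_at_within deriv
          simp flip: has_real_derivative_iff_has_vector_derivative)
    then show "(g n has_integral (F (a + real n) - F a)) {a..}"
      unfolding g_def by (subst has_integral_restrict) auto
  next
    show "g n x \<le> g (Suc n) x" if "x \<in> {a..}" for n x
      using that nonneg by (auto simp: g_def)
  next
    fix x assume x: "x \<in> {a..}"
    have "\<forall>\<^sub>F n in sequentially. g n x = f x"
      using eventually_ge_at_top[of "nat \<lceil>x - a\<rceil>"]
    proof eventually_elim
      case (elim n)
      then have "x \<le> a + real n" by linarith
      with x show ?case by (simp add: g_def)
    qed
    then show "(\<lambda>n. g n x) \<longlonglongrightarrow> f x"
      by (rule tendsto_eventually)
  next
    have "filterlim (\<lambda>n. a + real n) at_top sequentially"
      by (intro filterlim_tendsto_add_at_top[OF tendsto_const] filterlim_real_sequentially)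
    from filterlim_compose[OF lim this]
    show "(\<lambda>n. F (a + real n) - F a) \<longlonglongrightarrow> L - F a"
      by (intro tendsto_intros)
  qed
  then show ?thesis
    by (rule has_integral_spike_set_eq[THEN iffD1, rotated 2])
      (auto intro: negligible_subset[of "{a}"])
qed

text \<open>
  For \<open>a \<noteq> b\<close> partial fractions give a difference of two arctangents divided by \<open>b\<^sup>2 - a\<^sup>2\<close>. The value
  extends continuously to \<open>a = b\<close>, but the antiderivative has to be replaced by its limit, which
  contains a rational term. The diagonal case occurs in the series whenever \<open>y\<close> is an odd integer.
\<close>
lemma has_integral_inverse_quadratic_product:
  fixes a b :: real
  assumes "a > 0" "b > 0"
  shows "((\<lambda>x. 1 / ((x\<^sup>2 + a\<^sup>2) * (x\<^sup>2 + b\<^sup>2))) has_integral pi / (2 * a * b * (a + b))) {0<..}"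
proof -
  have pos: "x\<^sup>2 + c\<^sup>2 > 0" if "c > 0" for x c :: real
    using that by (simp add: add_nonneg_pos)
  define A where "A = (\<lambda>c x :: real. arctan (x / c) / c)"
  have der: "(A c has_real_derivative 1 / (x\<^sup>2 + c\<^sup>2)) (at x)" if "c > 0" for x c :: real
    unfolding A_def using that pos[OF that, of x]
    by (auto intro!: derivative_eq_intros simp: divide_simps)
      (simp add: algebra_simps power2_eq_square)
  have lim: "(A c \<longlongrightarrow> pi / (2 * c)) at_top" if "c > 0" for c :: real
  proof -
    have "(A c \<longlongrightarrow> pi * inverse c / 2) at_top"
      unfolding A_def using that by real_asymp
    then show ?thesis by (simp add: field_simps)
  qed
  have A0: "A c 0 = 0" for c by (simp add: A_def)
  show ?thesis
  proof (cases "a = b")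
    case True
    define F where "F = (\<lambda>x. (x / (x\<^sup>2 + a\<^sup>2) + A a x) / (2 * a\<^sup>2))"
    have "((\<lambda>x. 1 / ((x\<^sup>2 + a\<^sup>2) * (x\<^sup>2 + a\<^sup>2))) has_integral
        ((0 + pi / (2 * a)) / (2 * a\<^sup>2) - F 0)) {0<..}"
    proof (rule has_integral_FTC_greaterThan)
      show "(F has_real_derivative 1 / ((x\<^sup>2 + a\<^sup>2) * (x\<^sup>2 + a\<^sup>2))) (at x)" for x
      proof -
        have "((\<lambda>x. x / (x\<^sup>2 + a\<^sup>2)) has_real_derivative (a\<^sup>2 - x\<^sup>2) / (x\<^sup>2 + a\<^sup>2)\<^sup>2) (at x)"
          using pos[OF assms(1), of x]
          by (auto intro!: derivative_eq_intros simp: power2_eq_square)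
        then have "(F has_real_derivative ((a\<^sup>2 - x\<^sup>2) / (x\<^sup>2 + a\<^sup>2)\<^sup>2 + 1 / (x\<^sup>2 + a\<^sup>2)) / (2 * a\<^sup>2)) (at x)"
          unfolding F_def by (intro DERIV_cdivide DERIV_add der assms)
        also have "((a\<^sup>2 - x\<^sup>2) / (x\<^sup>2 + a\<^sup>2)\<^sup>2 + 1 / (x\<^sup>2 + a\<^sup>2)) / (2 * a\<^sup>2) =
            1 / ((x\<^sup>2 + a\<^sup>2) * (x\<^sup>2 + a\<^sup>2))"
        proof -
          have "((2 * p - q) / q\<^sup>2 + 1 / q) / (2 * p) = 1 / (q * q)" if "p > 0" "q > 0" for p q :: real
            using that by (simp add: field_simps power2_eq_square)
          from this[of "a\<^sup>2" "x\<^sup>2 + a\<^sup>2"] show ?thesis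
            using assms pos[OF assms(1), of x] by simp
        qed
        finally show ?thesis .
      qed
      have "((\<lambda>x. x / (x\<^sup>2 + a\<^sup>2)) \<longlongrightarrow> 0) at_top"
        by real_asymp
      then show "(F \<longlongrightarrow> (0 + pi / (2 * a)) / (2 * a\<^sup>2)) at_top"
        unfolding F_def using assms by (intro tendsto_divide tendsto_add lim tendsto_const) auto
    qed (use pos in \<open>simp add: less_imp_le\<close>)
    with True assms show ?thesis by (simp add: F_def A0 power2_eq_square algebra_simps)
  next
    case False
    define F where "F = (\<lambda>x. (A a x - A b x) / (b\<^sup>2 - a\<^sup>2))"
    have ne: "b\<^sup>2 - a\<^sup>2 \<noteq> 0" using False assms by (simp add: power2_eq_iff_nonneg)
    have "((\<lambda>x. 1 / ((x\<^sup>2 + a\<^sup>2) * (x\<^sup>2 + b\<^sup>2))) has_integral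
        ((pi / (2 * a) - pi / (2 * b)) / (b\<^sup>2 - a\<^sup>2) - F 0)) {0<..}"
    proof (rule has_integral_FTC_greaterThan)
      show "(F has_real_derivative 1 / ((x\<^sup>2 + a\<^sup>2) * (x\<^sup>2 + b\<^sup>2))) (at x)" for x
      proof -
        have "(F has_real_derivative (1 / (x\<^sup>2 + a\<^sup>2) - 1 / (x\<^sup>2 + b\<^sup>2)) / (b\<^sup>2 - a\<^sup>2)) (at x)"
          unfolding F_def by (intro DERIV_cdivide DERIV_diff der assms)
        also have "(1 / (x\<^sup>2 + a\<^sup>2) - 1 / (x\<^sup>2 + b\<^sup>2)) / (b\<^sup>2 - a\<^sup>2) = 1 / ((x\<^sup>2 + a\<^sup>2) * (x\<^sup>2 + b\<^sup>2))"
        proof -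
          have "(1 / p - 1 / q) / (q - p) = 1 / (p * q)" if "p > 0" "q > 0" "p \<noteq> q" for p q :: real
            using that by (simp add: divide_simps)
          from this[of "x\<^sup>2 + a\<^sup>2" "x\<^sup>2 + b\<^sup>2"] show ?thesis
            using ne pos[OF assms(1), of x] pos[OF assms(2), of x] by simp
        qed
        finally show ?thesis .
      qed
      show "(F \<longlongrightarrow> (pi / (2 * a) - pi / (2 * b)) / (b\<^sup>2 - a\<^sup>2)) at_top"
        unfolding F_def by (intro tendsto_divide tendsto_diff lim tendsto_const assms ne)
    qed (use pos assms in \<open>simp add: less_imp_le\<close>)
    moreover have "(pi / (2 * a) - pi / (2 * b)) / (b\<^sup>2 - a\<^sup>2) = pi / (2 * a * b * (a + b))"
    proof -
      have "b\<^sup>2 - a\<^sup>2 = (b - a) * (a + b)" by (simp add: power2_eq_square algebra_simps)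
      moreover have "pi / (2 * a) - pi / (2 * b) = (b - a) * (pi / (2 * a * b))"
        using assms by (simp add: field_simps)
      ultimately show ?thesis using False assms by (simp add: mult.assoc)
    qed
    ultimately show ?thesis by (simp add: F_def A0)
  qed
qed

text \<open>
  Neither \<open>x / (x\<^sup>2 + a\<^sup>2)\<close> nor \<open>x / (x\<^sup>2 + b\<^sup>2)\<close> is integrable, but the logarithmic
  divergences cancel. The integrand has the sign of \<open>b - a\<close>, so that monotone exhaustion of the
  half-line applies once \<open>a\<close> and \<open>b\<close> are ordered.
\<close>
lemma has_integral_quadratic_kernel_diff:
  fixes a b :: real
  assumes "a > 0" "b > 0"
  shows "((\<lambda>x. x / (x\<^sup>2 + a\<^sup>2) - x / (x\<^sup>2 + b\<^sup>2)) has_integral ln (b / a)) {0<..}"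
proof -
  have ordered: "((\<lambda>x. x / (x\<^sup>2 + a\<^sup>2) - x / (x\<^sup>2 + b\<^sup>2)) has_integral ln (b / a)) {0<..}"
    if "0 < a" "a \<le> b" for a b :: real
  proof -
    define F where "F = (\<lambda>x. ln (x\<^sup>2 + a\<^sup>2) / 2 - ln (x\<^sup>2 + b\<^sup>2) / 2)"
    have b: "b > 0" using that by simp
    have pos: "x\<^sup>2 + c\<^sup>2 > 0" if "c > 0" for x c :: real using that by (simp add: add_nonneg_pos)
    have "((\<lambda>x. x / (x\<^sup>2 + a\<^sup>2) - x / (x\<^sup>2 + b\<^sup>2)) has_integral (0 - F 0)) {0<..}"
    proof (rule has_integral_FTC_greaterThan)
      show "(F has_real_derivative x / (x\<^sup>2 + a\<^sup>2) - x / (x\<^sup>2 + b\<^sup>2)) (at x)" for x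
      proof -
        have "((\<lambda>x. ln (x\<^sup>2 + c\<^sup>2) / 2) has_real_derivative x / (x\<^sup>2 + c\<^sup>2)) (at x)" if "c > 0" for c
          using pos[OF that, of x] by (auto intro!: derivative_eq_intros simp: divide_simps)
        then show ?thesis
          unfolding F_def using that b by (intro DERIV_diff) auto
      qed
      show "x / (x\<^sup>2 + a\<^sup>2) - x / (x\<^sup>2 + b\<^sup>2) \<ge> 0" if "x \<ge> 0" for x
      proof -
        have "a\<^sup>2 \<le> b\<^sup>2" using \<open>0 < a\<close> \<open>a \<le> b\<close> by (simp add: power_mono)
        then have "x / (x\<^sup>2 + b\<^sup>2) \<le> x / (x\<^sup>2 + a\<^sup>2)"
          using that pos[OF \<open>0 < a\<close>, of x] by (intro divide_left_mono) (auto intro: mult_pos_pos pos b)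
        then show ?thesis by simp
      qed
      show "(F \<longlongrightarrow> 0) at_top"
        unfolding F_def by real_asymp
    qed
    moreover have "0 - F 0 = ln (b / a)"
      using that b by (simp add: F_def ln_div ln_realpow)
    ultimately show ?thesis by simp
  qed
  show ?thesis
  proof (cases "a \<le> b")
    case False
    have "((\<lambda>x. - (x / (x\<^sup>2 + b\<^sup>2) - x / (x\<^sup>2 + a\<^sup>2))) has_integral - ln (a / b)) {0<..}"
      using False assms by (intro has_integral_neg ordered) auto
    then show ?thesis using assms by (simp add: ln_div)
  qed (use assms ordered in auto)
qed

section \<open>Partial fractions of the hyperbolic tangent\<close>

lemma Digamma_diff_sums:
  fixes z w :: "'a :: {real_normed_field,banach}"
  assumes "z \<noteq> 0" "w \<noteq> 0"
  shows "(\<lambda>k. inverse (w + of_nat k) - inverse (z + of_nat k)) sums (Digamma z - Digamma w)"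
  using sums_diff[OF summable_sums[OF summable_Digamma[OF assms(1)]]
      summable_sums[OF summable_Digamma[OF assms(2)]]]
  by (simp add: Digamma_def algebra_simps)

text \<open>
  This is the logarithmic derivative of \<open>\<Gamma>(z) \<Gamma>(1 - z) = \<pi> / sin (\<pi>z)\<close>, computed with the
  entire function \<open>1/\<Gamma>\<close> so that nothing has to be divided before differentiating.
\<close>
lemma Digamma_reflection:
  fixes z :: complex
  assumes "z \<notin> \<int>"
  shows "Digamma (1 - z) - Digamma z = of_real pi * cot (of_real pi * z)"
proof -
  have z: "z \<notin> \<int>\<^sub>\<le>\<^sub>0" and z': "1 - z \<notin> \<int>\<^sub>\<le>\<^sub>0"
    using assms nonpos_Ints_Int Ints_diff[of 1 "1 - z"] by auto
  have rG: "rGamma u * rGamma (1 - u) = sin (of_real pi * u) / of_real pi" for u :: complex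
    by (rule rGamma_reflection_complex)
  have "((\<lambda>u. rGamma u * rGamma (1 - u)) has_field_derivative
      rGamma z * rGamma (1 - z) * (Digamma (1 - z) - Digamma z)) (at z)"
    by (rule derivative_eq_intros refl has_field_derivative_rGamma_no_nonpos_int[THEN DERIV_chain2] z z'
      | simp add: algebra_simps)+
  moreover have "((\<lambda>u. sin (of_real pi * u) / of_real pi) has_field_derivative cos (of_real pi * z)) (at z)"
    by (auto intro!: derivative_eq_intros)
  ultimately have "sin (of_real pi * z) / of_real pi * (Digamma (1 - z) - Digamma z) = cos (of_real pi * z)"
    unfolding rG by (rule DERIV_unique)
  moreover have "sin (of_real pi * z) \<noteq> 0"
    using rG[of z] z z' by (auto simp: rGamma_eq_zero_iff)
  ultimately show ?thesis by (simp add: cot_def field_simps)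
qed

text \<open>
  At \<open>z = 1/2 + ix/2\<close> the reflection \<open>z \<mapsto> 1 - z\<close> is complex conjugation, so
  \<open>\<psi>(1 - z) - \<psi>(z)\<close> is \<open>2i\<close> times the series of imaginary parts of \<open>1/(z + k)\<close>, while
  \<open>cot (\<pi>z) = - tan (i\<pi>x/2) = - i tanh (\<pi>x/2)\<close>.
\<close>
lemma tanh_partial_fractions:
  fixes x :: real
  shows "(\<lambda>k. 4 * x / (pi * (x\<^sup>2 + (2 * real k + 1)\<^sup>2))) sums tanh (pi * x / 2)"
proof -
  define z where "z = Complex (1 / 2) (x / 2)"
  have nz: "z \<notin> \<int>"
  proof
    assume "z \<in> \<int>"
    then obtain n :: int where "z = of_int n" by (auto elim: Ints_cases)
    then have "Re z = of_int n" by simp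
    then have "of_int (2 * n) = (1 :: real)" by (simp add: z_def)
    then have "2 * n = 1" by linarith
    then show False by presburger
  qed
  have "(\<lambda>k. inverse (z + of_nat k) - inverse (1 - z + of_nat k)) sums (Digamma (1 - z) - Digamma z)"
    using nz by (intro Digamma_diff_sums) auto
  also have "Digamma (1 - z) - Digamma z = - \<i> * of_real (pi * tanh (pi * x / 2))"
  proof -
    have "of_real pi * z = of_real pi / 2 + \<i> * of_real (pi * x / 2)"
      by (simp add: z_def complex_eq_iff)
    then have "cot (of_real pi * z) = - tan (\<i> * of_real (pi * x / 2))"
      by (simp only: cot_def tan_def sin_add cos_add) (simp flip: of_real_divide)
    also have "\<dots> = - \<i> * tanh (of_real (pi * x / 2))"
      by (simp add: tanh_conv_tan)
    also have "tanh (of_real (pi * x / 2)) = complex_of_real (tanh (pi * x / 2))"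
      by (simp add: tanh_def sinh_field_def cosh_field_def flip: exp_of_real)
    finally show ?thesis using Digamma_reflection[OF nz] by simp
  qed
  finally have sums: "(\<lambda>k. - Im (inverse (z + of_nat k) - inverse (1 - z + of_nat k)) / pi) sums
      (- Im (- \<i> * of_real (pi * tanh (pi * x / 2))) / pi)"
    by (intro sums_divide sums_minus sums_Im)
  moreover have "- Im (inverse (z + of_nat k) - inverse (1 - z + of_nat k)) / pi =
      4 * x / (pi * (x\<^sup>2 + (2 * real k + 1)\<^sup>2))" for k
  proof -
    have "(1/2 + real k)\<^sup>2 + (x/2)\<^sup>2 = (x\<^sup>2 + (2 * real k + 1)\<^sup>2) / 4"
      by (simp add: power2_eq_square algebra_simps)
    moreover have "- Im (inverse (z + of_nat k) - inverse (1 - z + of_nat k)) = x / ((1/2 + real k)\<^sup>2 + (x/2)\<^sup>2)"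
    proof -
      have "2 * x / (2 * u + 2 * v) = x / (u + v)" for u v :: real
        by (metis distrib_left mult_divide_mult_cancel_left_if zero_neq_numeral)
      then show ?thesis by (simp add: z_def)
    qed
    ultimately show ?thesis
      by (simp only:) (simp add: mult_ac)
  qed
  ultimately show ?thesis by simp
qed

section \<open>The integrals\<close>

text \<open>
  The terms of the expanded integrand are nonnegative on the half-line, so monotone
  convergence permits integrating the series termwise.
\<close>
lemma has_integral_tanh_kernel:
  fixes y :: real
  assumes "y > 0"
  shows "((\<lambda>x. tanh (pi * x / 2) * (1 / x - x / (x\<^sup>2 + y\<^sup>2))) has_integral
    (Digamma ((1 + y) / 2) - Digamma (1 / 2))) {0<..}"
proof -
  define f where "f = (\<lambda>k x. 4 * y\<^sup>2 / pi * (1 / ((x\<^sup>2 + y\<^sup>2) * (x\<^sup>2 + (2 * real k + 1)\<^sup>2))))"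
  have integral_f: "(f k has_integral
      (inverse (1 / 2 + real k) - inverse ((1 + y) / 2 + real k))) {0<..}" for k
  proof -
    have "(f k has_integral 4 * y\<^sup>2 / pi * (pi / (2 * y * (2 * real k + 1) * (y + (2 * real k + 1))))) {0<..}"
      unfolding f_def using assms
      by (intro has_integral_mult_right has_integral_inverse_quadratic_product) auto
    also have "4 * y\<^sup>2 / pi * (pi / (2 * y * (2 * real k + 1) * (y + (2 * real k + 1)))) =
        2 / (2 * real k + 1) - 2 / (y + (2 * real k + 1))"
    proof -
      have "2 * real k + 1 > 0" "y + (2 * real k + 1) > 0" using assms by auto
      then show ?thesis using assms by (simp add: divide_simps) (simp add: algebra_simps power2_eq_square)
    qed
    also have "2 / (2 * real k + 1) = inverse (1 / 2 + real k)"
      by (simp add: field_simps)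
    also have "2 / (y + (2 * real k + 1)) = inverse ((1 + y) / 2 + real k)"
      using assms by (simp add: field_simps)
    finally show ?thesis .
  qed
  show ?thesis
  proof (rule has_integral_monotone_convergence_increasing)
    show "((\<lambda>x. \<Sum>k<n. f k x) has_integral
        (\<Sum>k<n. inverse (1 / 2 + real k) - inverse ((1 + y) / 2 + real k))) {0<..}" for n
      by (intro has_integral_sum integral_f) auto
    show "(\<Sum>k<n. f k x) \<le> (\<Sum>k<Suc n. f k x)" for n x
      by (simp add: f_def)
    show "(\<lambda>n. \<Sum>k<n. f k x) \<longlonglongrightarrow> tanh (pi * x / 2) * (1 / x - x / (x\<^sup>2 + y\<^sup>2))"
      if "x \<in> {0<..}" for x
    proof -
      have q: "x\<^sup>2 + y\<^sup>2 > 0" using assms by (simp add: add_nonneg_pos)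
      have "1 / x - x / (x\<^sup>2 + y\<^sup>2) = y\<^sup>2 / (x * (x\<^sup>2 + y\<^sup>2))"
        using that q by (simp add: field_simps power2_eq_square)
      then have "4 * x / (pi * (x\<^sup>2 + (2 * real k + 1)\<^sup>2)) * (1 / x - x / (x\<^sup>2 + y\<^sup>2)) = f k x" for k
        using that by (simp add: f_def mult_ac)
      then show ?thesis
        using sums_mult2[OF tanh_partial_fractions, of x "1 / x - x / (x\<^sup>2 + y\<^sup>2)"]
        by (simp add: sums_def)
    qed
    show "(\<lambda>n. \<Sum>k<n. inverse (1 / 2 + real k) - inverse ((1 + y) / 2 + real k))
        \<longlonglongrightarrow> Digamma ((1 + y) / 2) - Digamma (1 / 2)"
      using Digamma_diff_sums[of "(1 + y) / 2" "1 / 2 :: real"] assms by (simp add: sums_def)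
  qed
qed

text \<open>
  Since \<open>1 - tanh (\<pi>x/2) \<le> 2 exp (-\<pi>x)\<close> and \<open>x / (x\<^sup>2 + y\<^sup>2) \<le> 1 / (2y)\<close>, the integrand is
  dominated by \<open>exp (-\<pi>x) / y\<close>. This gives both the existence of the integral and
  its decay for large \<open>y\<close>, which later fixes the constant of integration.
\<close>
lemma one_minus_tanh_kernel_integral_bound:
  fixes y :: real
  assumes "y > 0"
  obtains I where
    "((\<lambda>x. x / (x\<^sup>2 + y\<^sup>2) - x / (x\<^sup>2 + y\<^sup>2) * tanh (pi * x / 2)) has_integral I) {0<..}"
    "0 \<le> I" "I \<le> 1 / (pi * y)"
proof -
  define f where "f = (\<lambda>x. x / (x\<^sup>2 + y\<^sup>2) - x / (x\<^sup>2 + y\<^sup>2) * tanh (pi * x / 2))"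
  have q: "x\<^sup>2 + y\<^sup>2 > 0" for x using assms by (simp add: add_nonneg_pos)
  have bounds: "0 \<le> f x" "f x \<le> exp (- pi * x) / y" if "x > 0" for x
  proof -
    define e where "e = exp (- pi * x)"
    have e: "e > 0" by (simp add: e_def)
    have f_eq: "f x = x / (x\<^sup>2 + y\<^sup>2) * (1 - tanh (pi * x / 2))"
      by (simp add: f_def right_diff_distrib)
    have "1 - tanh (pi * x / 2) = 2 * e / (1 + e)"
    proof -
      have "tanh (pi * x / 2) = (1 - e) / (1 + e)" by (simp add: tanh_real_altdef e_def)
      then show ?thesis using e by (simp add: field_simps)
    qed
    moreover have "2 * e / (1 + e) \<le> 2 * e" using e by (simp add: field_simps)
    ultimately have t: "0 \<le> 1 - tanh (pi * x / 2)" "1 - tanh (pi * x / 2) \<le> 2 * e"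
      using e by auto
    have "0 \<le> (x - y)\<^sup>2" by simp
    then have "x * (2 * y) \<le> x\<^sup>2 + y\<^sup>2" by (simp add: power2_eq_square algebra_simps)
    then have k: "x / (x\<^sup>2 + y\<^sup>2) \<le> 1 / (2 * y)" using assms q[of x] by (simp add: divide_simps)
    show "0 \<le> f x" unfolding f_eq using that q[of x] t by simp
    have "f x \<le> 1 / (2 * y) * (2 * e)"
      unfolding f_eq using that q[of x] t assms by (intro mult_mono k t) auto
    then show "f x \<le> exp (- pi * x) / y" using assms by (simp add: e_def)
  qed
  have "((\<lambda>x. exp (- pi * x) / y) has_integral (0 - (- exp (- pi * 0) / (pi * y)))) {0<..}"
  proof (rule has_integral_FTC_greaterThan)
    show "((\<lambda>x. - exp (- pi * x) / (pi * y)) has_real_derivative exp (- pi * x) / y) (at x)" for x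
      using assms by (auto intro!: derivative_eq_intros)
    show "((\<lambda>x. - exp (- pi * x) / (pi * y)) \<longlongrightarrow> 0) at_top"
      using assms by real_asymp
  qed (use assms in simp)
  then have majorant: "((\<lambda>x. exp (- pi * x) / y) has_integral 1 / (pi * y)) {0<..}" by simp
  have "continuous_on {0<..} f"
    unfolding f_def using q by (auto intro!: continuous_intros simp: less_imp_neq[symmetric] cosh_real_nonzero)
  then have "f \<in> borel_measurable (lebesgue_on {0<..})"
    by (rule continuous_imp_measurable_on_sets_lebesgue) simp
  then have "f integrable_on {0<..}"
    using bounds by (rule_tac measurable_bounded_by_integrable_imp_integrable[OF _ has_integral_integrable[OF majorant]])
      auto
  then obtain I where I: "(f has_integral I) {0<..}" by (auto simp: integrable_on_def)
  show thesis
  proof (rule that)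
    show "0 \<le> I" using I by (rule has_integral_nonneg) (use bounds in auto)
    show "I \<le> 1 / (pi * y)" using I majorant by (rule has_integral_le) (use bounds in auto)
  qed (use I in \<open>simp add: f_def\<close>)
qed

text \<open>
  The dependence of the integral on \<open>y\<close> is known up to an additive constant from \<open>has_integral_tanh_kernel\<close>;
  comparison with the parameters \<open>c = 2n + 1\<close>, \<open>n \<rightarrow> \<infinity>\<close>, determines that constant.
\<close>
lemma has_integral_one_minus_tanh_kernel:
  fixes y :: real
  assumes "y > 0"
  shows "((\<lambda>x. x / (x\<^sup>2 + y\<^sup>2) - x / (x\<^sup>2 + y\<^sup>2) * tanh (pi * x / 2)) has_integral
    (Digamma ((1 + y) / 2) + ln (2 / y))) {0<..}"
proof -
  define f where "f = (\<lambda>c x :: real. x / (x\<^sup>2 + c\<^sup>2) - x / (x\<^sup>2 + c\<^sup>2) * tanh (pi * x / 2))"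
  define I where "I = (\<lambda>c. integral {0<..} (f c))"
  have I: "(f c has_integral I c) {0<..}" "0 \<le> I c" "I c \<le> 1 / (pi * c)" if c: "c > 0" for c
  proof -
    obtain J where J: "(f c has_integral J) {0<..}" "0 \<le> J" "J \<le> 1 / (pi * c)"
      using one_minus_tanh_kernel_integral_bound[OF c] unfolding f_def by blast
    moreover have "I c = J" unfolding I_def by (rule integral_unique) (rule J)
    ultimately show "(f c has_integral I c) {0<..}" "0 \<le> I c" "I c \<le> 1 / (pi * c)" by simp_all
  qed
  \<comment> \<open>\<open>I y - I c\<close> is evaluated by splitting its integrand into the difference of the two rational
    kernels and a difference of two integrals of the kind in \<open>has_integral_tanh_kernel\<close>.\<close>
  have shift: "I y = Digamma ((1 + y) / 2) - Digamma ((1 + c) / 2) + ln (c / y) + I c" if "c > 0" for c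
  proof -
    have "((\<lambda>x. x / (x\<^sup>2 + y\<^sup>2) - x / (x\<^sup>2 + c\<^sup>2)
          - (tanh (pi * x / 2) * (1 / x - x / (x\<^sup>2 + c\<^sup>2)) - tanh (pi * x / 2) * (1 / x - x / (x\<^sup>2 + y\<^sup>2))))
        has_integral ln (c / y) - ((Digamma ((1 + c) / 2) - Digamma (1 / 2))
          - (Digamma ((1 + y) / 2) - Digamma (1 / 2)))) {0<..}"
      by (intro has_integral_diff has_integral_quadratic_kernel_diff has_integral_tanh_kernel assms that)
    moreover have "((\<lambda>x. f y x - f c x) has_integral I y - I c) {0<..}"
      by (intro has_integral_diff I assms that)
    then have "((\<lambda>x. x / (x\<^sup>2 + y\<^sup>2) - x / (x\<^sup>2 + c\<^sup>2)
          - (tanh (pi * x / 2) * (1 / x - x / (x\<^sup>2 + c\<^sup>2)) - tanh (pi * x / 2) * (1 / x - x / (x\<^sup>2 + y\<^sup>2))))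
        has_integral I y - I c) {0<..}"
      by (rule has_integral_eq[rotated]) (simp add: f_def algebra_simps)
    ultimately have "ln (c / y) - ((Digamma ((1 + c) / 2) - Digamma (1 / 2))
          - (Digamma ((1 + y) / 2) - Digamma (1 / 2))) = I y - I c"
      by (rule has_integral_unique)
    then show ?thesis by simp
  qed
  \<comment> \<open>With this choice \<open>(1 + c n) / 2 = n + 1\<close>, where the digamma function is a harmonic number
    minus \<open>\<gamma>\<close>.\<close>
  define c where "c = (\<lambda>n :: nat. 2 * real n + 1)"
  have c: "c n > 0" for n by (simp add: c_def)
  have I_lim: "(\<lambda>n. I (c n)) \<longlonglongrightarrow> 0"
  proof (rule tendsto_sandwich[OF _ _ tendsto_const])
    show "(\<lambda>n. 1 / (pi * c n)) \<longlonglongrightarrow> 0" unfolding c_def by real_asymp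
  qed (use I c in auto)
  have Digamma_lim: "(\<lambda>n. ln (c n / 2) - Digamma ((1 + c n) / 2)) \<longlonglongrightarrow> 0"
  proof -
    have "(\<lambda>n. (ln (c n / 2) - ln (real n)) - (harm n - ln (real n)) + euler_mascheroni)
        \<longlonglongrightarrow> 0 - euler_mascheroni + euler_mascheroni"
    proof (intro tendsto_add tendsto_diff tendsto_const euler_mascheroni_LIMSEQ)
      show "(\<lambda>n. ln (c n / 2) - ln (real n)) \<longlonglongrightarrow> 0" unfolding c_def by real_asymp
    qed
    moreover have "Digamma ((1 + c n) / 2) = harm n - euler_mascheroni" for n
      using Digamma_of_nat[of n, where 'a = real] by (simp add: c_def add_divide_distrib add.commute)
    ultimately show ?thesis
      by (simp only:) (simp add: algebra_simps)
  qed
  have "(\<lambda>n. Digamma ((1 + y) / 2) + ln (2 / y)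
      + (ln (c n / 2) - Digamma ((1 + c n) / 2)) + I (c n)) \<longlonglongrightarrow>
      Digamma ((1 + y) / 2) + ln (2 / y) + 0 + 0"
    by (intro tendsto_add tendsto_const I_lim Digamma_lim)
  moreover have "Digamma ((1 + y) / 2) + ln (2 / y) + (ln (c n / 2) - Digamma ((1 + c n) / 2)) + I (c n) = I y" for n
    using shift[OF c[of n]] c[of n] assms by (simp add: ln_div)
  ultimately have "I y = Digamma ((1 + y) / 2) + ln (2 / y)"
    by (simp add: LIMSEQ_const_iff)
  then show ?thesis using I(1)[OF assms] by (simp add: f_def)
qed

theorem proposition2:
  fixes y :: real
  shows "(y \<noteq> 0 \<longrightarrow>
            ((\<lambda>x. x / (x^2 + y^2) - x / (x^2 + y^2) * tanh (pi * x / 2))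
               has_integral (Digamma ((1 + \<bar>y\<bar>) / 2) + ln (2 / \<bar>y\<bar>))) {0<..}) \<and>
         (y \<noteq> 0 \<longrightarrow>
            ((\<lambda>x. tanh (pi * x / 2) / x - x / (x^2 + y^2))
               has_integral (euler_mascheroni + ln (2 * \<bar>y\<bar>))) {0<..}) \<and>
         ((\<lambda>x. tanh (pi * x / 2) * (1 / x - x / (x^2 + y^2)))
               has_integral (- Digamma (1 / 2) + Digamma ((1 + \<bar>y\<bar>) / 2))) {0<..}"
proof (cases "y = 0")
  case True
  \<comment> \<open>Here \<open>1/x - x/x\<^sup>2\<close> vanishes on the half-line and both digamma terms are taken at \<open>1/2\<close>.\<close>
  have "((\<lambda>x. 0) has_integral (0 :: real)) {0::real<..}" by simp
  then have "((\<lambda>x. tanh (pi * x / 2) * (1 / x - x / x\<^sup>2)) has_integral 0) {0<..}"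
    by (rule has_integral_eq[rotated]) (simp add: power2_eq_square)
  with True show ?thesis by simp
next
  case False
  have first: "((\<lambda>x. x / (x\<^sup>2 + y\<^sup>2) - x / (x\<^sup>2 + y\<^sup>2) * tanh (pi * x / 2)) has_integral
      (Digamma ((1 + \<bar>y\<bar>) / 2) + ln (2 / \<bar>y\<bar>))) {0<..}"
    using has_integral_one_minus_tanh_kernel[of "\<bar>y\<bar>"] False by simp
  have third: "((\<lambda>x. tanh (pi * x / 2) * (1 / x - x / (x\<^sup>2 + y\<^sup>2))) has_integral
      (Digamma ((1 + \<bar>y\<bar>) / 2) - Digamma (1 / 2))) {0<..}"
    using has_integral_tanh_kernel[of "\<bar>y\<bar>"] False by simp
  have "Digamma ((1 + \<bar>y\<bar>) / 2) - Digamma (1 / 2) - (Digamma ((1 + \<bar>y\<bar>) / 2) + ln (2 / \<bar>y\<bar>)) =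
      euler_mascheroni + ln (2 * \<bar>y\<bar>)"
    using False by (simp add: Digamma_one_half ln_div ln_mult)
  with has_integral_diff[OF third first]
  have "((\<lambda>x. tanh (pi * x / 2) / x - x / (x\<^sup>2 + y\<^sup>2)) has_integral
      (euler_mascheroni + ln (2 * \<bar>y\<bar>))) {0<..}"
    by (simp add: algebra_simps)
  with first third show ?thesis by simp
qed

end
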